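(* Let $m\ge 2$ and let $(\mathcal{A},\mathcal{X})$ be a 3-net in $\mathbb{P}^2$ realizing the cyclic group $\mathbb{Z}_m$. Then this net is algebraic.
   Context: A 3-net in $\mathbb{P}^2$ is a pair $(\mathcal{A},\mathcal{X})$ where $\mathcal{A}$ is a finite set of lines in the complex projective plane partitioned into 3 classes $\mathcal{A}=\mathcal{A}_1\cup\mathcal{A}_2\cup\mathcal{A}_3$ and $\mathcal{X}$ is a finite set of points such that: (i) for every $i\neq j$ and every $l\in\mathcal{A}_i$, $l'\in\mathcal{A}_j$, $l\cap l'\in\mathcal{X}$; (ii) for every $X\in\mathcal{X}$ and every $i$ there is a unique $l\in\mathcal{A}_i$ through $X$. A 3-net realizes a group $H$ if there are bijections $\phi_i:H\to\mathcal{A}_i$ ($i=1,2,3$) such that for all $a,b\in H$ the line $\phi_3(ab)$ passes through the point $\phi_1(a)\cap\phi_2(b)$. Let $\mathcal{A}^*$ be the set of points in the dual projective plane $\mathbb{P}^*$ dual to the lines of $\mathcal{A}$. The 3-net is algebraic if there exists a cubic curve $\mathcal{C}\subset\mathbb{P}^*$ (not necessarily smooth or irreducible) such that $\mathcal{A}^*$ is contained in the set of regular (nonsingular) points of $\mathcal{C}$. *)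

theory Defs
  imports "HOL-Analysis.Analysis" "HOL-Algebra.Elementary_Groups"
begin

text \<open>
  Points and lines of the complex projective plane are the linear subspaces of
  \<open>\<complex>\<^sup>3\<close> of dimension 1 and 2. Incidence is inclusion, and the common point of two
  distinct lines is literally their intersection.
\<close>

definition proj_point :: "(complex ^ 3) set \<Rightarrow> bool" where
  "proj_point P \<longleftrightarrow> vec.subspace P \<and> vec.dim P = 1"

definition proj_line :: "(complex ^ 3) set \<Rightarrow> bool" where
  "proj_line l \<longleftrightarrow> vec.subspace l \<and> vec.dim l = 2"

text \<open>
  The index type \<open>3\<close> has the elements \<open>1\<close>, \<open>2\<close> and \<open>3 = 0\<close>.
\<close>

definition three_net ::
  "(3 \<Rightarrow> (complex ^ 3) set set) \<Rightarrow> (complex ^ 3) set set \<Rightarrow> bool" where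
  "three_net A X \<longleftrightarrow>
     finite (\<Union>i. A i) \<and> (\<forall>i. \<forall>l\<in>A i. proj_line l) \<and>
     (\<forall>i. A i \<noteq> {}) \<and> (\<forall>i j. i \<noteq> j \<longrightarrow> A i \<inter> A j = {}) \<and>
     finite X \<and> (\<forall>P\<in>X. proj_point P) \<and>
     (\<forall>i j. i \<noteq> j \<longrightarrow> (\<forall>l\<in>A i. \<forall>l'\<in>A j. l \<inter> l' \<in> X)) \<and>
     (\<forall>P\<in>X. \<forall>i. \<exists>!l. l \<in> A i \<and> P \<subseteq> l)"

definition net_realizes ::
  "(3 \<Rightarrow> (complex ^ 3) set set) \<Rightarrow> ('g, 'r) monoid_scheme \<Rightarrow> bool" where
  "net_realizes A H \<longleftrightarrow>
     (\<exists>\<phi> :: 3 \<Rightarrow> 'g \<Rightarrow> (complex ^ 3) set.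
        (\<forall>i. bij_betw (\<phi> i) (carrier H) (A i)) \<and>
        (\<forall>a\<in>carrier H. \<forall>b\<in>carrier H. \<phi> 1 a \<inter> \<phi> 2 b \<subseteq> \<phi> 3 (a \<otimes>\<^bsub>H\<^esub> b)))"

text \<open>
  The dual space is identified with \<open>\<complex>\<^sup>3\<close> by sending \<open>u\<close> to the functional
  \<open>x \<mapsto> \<Sum>i. u\<^sub>i x\<^sub>i\<close> (bilinear, without conjugation). The point of the dual plane
  given by a line is its annihilator.
\<close>

definition dual_point :: "(complex ^ 3) set \<Rightarrow> (complex ^ 3) set" where
  "dual_point l = {u. \<forall>x\<in>l. (\<Sum>i\<in>UNIV. u $ i * x $ i) = 0}"

text \<open>
  A ternary cubic form is given by its coefficients \<open>c e\<close> at the monomials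
  \<open>x\<^sub>1\<^bsup>e 1\<^esup> x\<^sub>2\<^bsup>e 2\<^esup> x\<^sub>3\<^bsup>e 3\<^esup>\<close> of total degree 3. Values of \<open>c\<close> at other exponents are
  ignored throughout.
\<close>

definition cubic_exponents :: "(3 \<Rightarrow> nat) set" where
  "cubic_exponents = {e. (\<Sum>i\<in>UNIV. e i) = 3}"

definition cubic_eval :: "((3 \<Rightarrow> nat) \<Rightarrow> complex) \<Rightarrow> complex ^ 3 \<Rightarrow> complex" where
  "cubic_eval c x = (\<Sum>e\<in>cubic_exponents. c e * (\<Prod>j\<in>UNIV. x $ j ^ e j))"

definition cubic_partial ::
  "3 \<Rightarrow> ((3 \<Rightarrow> nat) \<Rightarrow> complex) \<Rightarrow> complex ^ 3 \<Rightarrow> complex" where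
  "cubic_partial i c x =
     (\<Sum>e\<in>cubic_exponents.
        c e * of_nat (e i) * (\<Prod>j\<in>UNIV. x $ j ^ (if j = i then e j - 1 else e j)))"

definition cubic_nonzero :: "((3 \<Rightarrow> nat) \<Rightarrow> complex) \<Rightarrow> bool" where
  "cubic_nonzero c \<longleftrightarrow> (\<exists>e\<in>cubic_exponents. c e \<noteq> 0)"

definition cubic_curve :: "((3 \<Rightarrow> nat) \<Rightarrow> complex) \<Rightarrow> (complex ^ 3) set set" where
  "cubic_curve c = {P. proj_point P \<and> (\<forall>u\<in>P. cubic_eval c u = 0)}"

text \<open>
  Regularity refers to the given equation, so points on a multiple component
  are singular.
\<close>

definition regular_points :: "((3 \<Rightarrow> nat) \<Rightarrow> complex) \<Rightarrow> (complex ^ 3) set set" where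
  "regular_points c =
     {P \<in> cubic_curve c. \<forall>u\<in>P. u \<noteq> 0 \<longrightarrow> (\<exists>i. cubic_partial i c u \<noteq> 0)}"

definition algebraic_net :: "(3 \<Rightarrow> (complex ^ 3) set set) \<Rightarrow> bool" where
  "algebraic_net A \<longleftrightarrow>
     (\<exists>c. cubic_nonzero c \<and> dual_point ` (\<Union>i. A i) \<subseteq> regular_points c)"

end

theory Submission imports Defs begin

text \<open>
  Dually, the net consists of points \<open>a\<^sub>i\<close>, \<open>b\<^sub>j\<close>, \<open>c\<^sub>k\<close> with indices modulo \<open>m\<close> such that
  \<open>a\<^sub>i\<close>, \<open>b\<^sub>j\<close>, \<open>c\<^sub>k\<close> are collinear iff \<open>i + j + k = 0\<close>, and no further collinearities involve
  two different classes. Three consecutive points of each class, with matching indices, form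
  a \<open>3 \<times> 3\<close> grid, so by Chasles' theorem a cubic through eight of them contains the ninth.
  There is a nonzero cubic through any nine points; taking \<open>a\<^sub>0, \<dots>, a\<^sub>3, b\<^sub>0, b\<^sub>1, b\<^sub>2, c\<^sub>-\<^sub>1, c\<^sub>-\<^sub>2\<close>
  and sliding the grid shows that it contains all points of the net. If it were singular at a
  point of the net, it would contain each of the \<open>m\<close> lines joining this point to the other classes,
  which is impossible for \<open>m \<ge> 4\<close>. For \<open>m = 2, 3\<close> suitable products of three lines, each
  point lying on exactly one of them, do the job.
\<close>

section \<open>Linear algebra in dimension three\<close>

definition dotp :: "complex ^ 3 \<Rightarrow> complex ^ 3 \<Rightarrow> complex" where
  "dotp u x = (\<Sum>i\<in>UNIV. u $ i * x $ i)"

definition cross :: "complex ^ 3 \<Rightarrow> complex ^ 3 \<Rightarrow> complex ^ 3" where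
  "cross u v = vector [u $ 2 * v $ 3 - u $ 3 * v $ 2, u $ 3 * v $ 1 - u $ 1 * v $ 3,
                       u $ 1 * v $ 2 - u $ 2 * v $ 1]"

definition det3 :: "complex ^ 3 \<Rightarrow> complex ^ 3 \<Rightarrow> complex ^ 3 \<Rightarrow> complex" where
  "det3 u v w = u $ 1 * (v $ 2 * w $ 3 - v $ 3 * w $ 2)
              - u $ 2 * (v $ 1 * w $ 3 - v $ 3 * w $ 1)
              + u $ 3 * (v $ 1 * w $ 2 - v $ 2 * w $ 1)"

lemma dotp_3: "dotp u x = u $ 1 * x $ 1 + u $ 2 * x $ 2 + u $ 3 * x $ 3"
  by (simp add: dotp_def sum_3)

lemma det3_eq_dotp_cross: "det3 u v w = dotp (cross u v) w"
  by (simp add: det3_def dotp_3 cross_def algebra_simps)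

lemma det3_linear: "det3 u v (s *s x + t *s y) = s * det3 u v x + t * det3 u v y"
  by (simp add: det3_def algebra_simps)

lemma det3_swap: "det3 u w v = - det3 u v w"
  by (simp add: det3_def algebra_simps)

lemma det3_repeat [simp]: "det3 u u w = 0" "det3 u v u = 0" "det3 u v v = 0"
  by (simp_all add: det3_def algebra_simps)

lemma det3_rotate: "det3 v w u = det3 u v w"
  by (simp add: det3_def algebra_simps)

lemma cramer: "det3 u v w *s x = det3 x v w *s u + det3 u x w *s v + det3 u v x *s w"
  by (simp add: vec_eq_iff forall_3 det3_def algebra_simps)

text \<open>\<open>w\<close> certifies that \<open>u\<close> and \<open>v\<close> are independent.
  In Cramer's identity the coefficient of \<open>w\<close> is \<open>det3 u v x\<close>, which
  vanishes.\<close>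

lemma span_of_det3_eq_0:
  assumes "det3 u v x = 0" "det3 u v w \<noteq> 0"
  obtains s t where "x = s *s u + t *s v"
proof
  have "det3 u v w *s x = det3 x v w *s u + det3 u x w *s v"
    using cramer[of u v w x] assms(1) by simp
  then have "x = (1 / det3 u v w) *s (det3 x v w *s u + det3 u x w *s v)"
    using assms(2) by (metis divide_inverse mult.left_neutral vector_smult_assoc left_inverse vector_smult_lid)
  then show "x = (det3 x v w / det3 u v w) *s u + (det3 u x w / det3 u v w) *s v"
    by (simp add: vector_add_ldistrib vector_smult_assoc)
qed

lemma dotp_neq_0_witness:
  assumes "u \<noteq> 0"
  obtains w where "dotp u w \<noteq> 0"
proof -
  obtain i where "u $ i \<noteq> 0" using assms by (auto simp: vec_eq_iff)
  then have "dotp u (axis i 1) \<noteq> 0"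
    by (simp add: dotp_def axis_def if_distrib cong: if_cong)
  then show thesis by (rule that)
qed

lemma scaled_of_proportional:
  fixes u n :: "complex ^ 3"
  assumes "n \<noteq> 0" "\<And>i j. u $ i * n $ j = u $ j * n $ i"
  obtains t where "u = t *s n"
proof -
  obtain i where i: "n $ i \<noteq> 0" using assms(1) by (auto simp: vec_eq_iff)
  have "u = (u $ i / n $ i) *s n"
    using i assms(2)[of i] by (simp add: vec_eq_iff field_simps)
  then show thesis by (rule that)
qed

lemma scaled_of_cross_eq_0:
  assumes "cross u v = 0" "u \<noteq> 0"
  obtains t where "v = t *s u"
proof (rule scaled_of_proportional[OF assms(2)])
  fix i j :: 3
  show "v $ i * u $ j = v $ j * u $ i"
    using assms(1) exhaust_3[of i] exhaust_3[of j]
    by (auto simp: cross_def vec_eq_iff forall_3 algebra_simps)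
qed (rule that)

lemma scaled_cross_of_orthogonal:
  assumes "cross p q \<noteq> 0" "dotp u p = 0" "dotp u q = 0"
  obtains t where "u = t *s cross p q"
proof (rule scaled_of_proportional[OF assms(1)])
  fix i j :: 3
  have "u $ i * cross p q $ j - u $ j * cross p q $ i = 0"
  proof -
    \<comment> \<open>Components of the triple product \<open>u\<close> x (\<open>p\<close> x
      \<open>q\<close>), which expands to \<open>p\<close> times \<open>dotp u q\<close> minus
      \<open>q\<close> times \<open>dotp u p\<close>.\<close>
    have "u $ 1 * cross p q $ 2 - u $ 2 * cross p q $ 1 = p $ 3 * dotp u q - q $ 3 * dotp u p"
         "u $ 2 * cross p q $ 3 - u $ 3 * cross p q $ 2 = p $ 1 * dotp u q - q $ 1 * dotp u p"
         "u $ 3 * cross p q $ 1 - u $ 1 * cross p q $ 3 = p $ 2 * dotp u q - q $ 2 * dotp u p"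
      by (simp_all add: cross_def dotp_3 algebra_simps)
    then show ?thesis using assms(2,3) exhaust_3[of i] exhaust_3[of j] by auto
  qed
  then show "u $ i * cross p q $ j = u $ j * cross p q $ i" by simp
qed (rule that)

lemma dotp_cross [simp]: "dotp u (cross u v) = 0" "dotp v (cross u v) = 0"
  "dotp (cross u v) u = 0" "dotp (cross u v) v = 0"
  by (simp_all add: cross_def dotp_3 algebra_simps)

lemma dotp_scale [simp]: "dotp (t *s u) x = t * dotp u x" "dotp u (t *s x) = t * dotp u x"
  by (simp_all add: dotp_3 algebra_simps)

lemma dotp_add: "dotp u (x + y) = dotp u x + dotp u y"
  by (simp add: dotp_3 algebra_simps)

section \<open>Normal vectors of lines and duality\<close>

text \<open>The cross product of a basis of \<open>l\<close> spans the annihilator of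
  \<open>l\<close>. Each line of the net can thus be replaced by one dual vector, and incidences by
  determinants.\<close>

lemma proj_line_normal:
  assumes "proj_line l"
  obtains u where "u \<noteq> 0" "l = {x. dotp u x = 0}" "dual_point l = range (\<lambda>t. t *s u)"
proof -
  have sub: "vec.subspace l" and "vec.dim l = 2" using assms by (auto simp: proj_line_def)
  then obtain B where B: "B \<subseteq> l" "vec.independent B" "l \<subseteq> vec.span B" "card B = 2"
    using vec.basis_exists[of l] by metis
  then obtain p q where pq: "B = {p, q}" "p \<noteq> q" by (auto simp: card_2_iff)
  have p0: "p \<noteq> 0" using B(2) pq vec.dependent_zero[of B] by auto
  have n0: "cross p q \<noteq> 0"
  proof
    assume "cross p q = 0"
    then obtain t where "q = t *s p" using scaled_of_cross_eq_0 p0 by blast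
    then have "q \<in> vec.span {p}" unfolding vec.span_singleton by blast
    moreover have "{p, q} - {q} = {p}" using pq(2) by auto
    ultimately show False using B(2) pq(1) vec.dependent_def[of B] by auto
  qed
  then obtain w where w: "det3 p q w \<noteq> 0"
    using dotp_neq_0_witness by (auto simp: det3_eq_dotp_cross)
  have l: "l = {x. dotp (cross p q) x = 0}"
  proof (intro equalityI subsetI)
    have "vec.subspace {x. dotp (cross p q) x = 0}"
      by (rule vec.subspaceI) (simp_all add: dotp_add, simp add: dotp_3)
    then have "vec.span B \<subseteq> {x. dotp (cross p q) x = 0}"
      by (intro vec.span_minimal) (auto simp: pq)
    then show "x \<in> {x. dotp (cross p q) x = 0}" if "x \<in> l" for x using that B(3) by blast
  next
    fix x assume "x \<in> {x. dotp (cross p q) x = 0}"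
    then have "det3 p q x = 0" by (simp add: det3_eq_dotp_cross)
    then obtain s t where "x = s *s p + t *s q" using span_of_det3_eq_0 w by blast
    then show "x \<in> l" using sub B(1) pq(1) by (auto intro: vec.subspace_add vec.subspace_scale)
  qed
  have "dual_point l = range (\<lambda>t. t *s cross p q)"
  proof (intro equalityI subsetI)
    fix u assume "u \<in> dual_point l"
    then have "dotp u p = 0" "dotp u q = 0" using B(1) pq(1) by (auto simp: dual_point_def dotp_def)
    then obtain t where "u = t *s cross p q" using scaled_cross_of_orthogonal n0 by blast
    then show "u \<in> range (\<lambda>t. t *s cross p q)" by blast
  next
    fix u assume "u \<in> range (\<lambda>t. t *s cross p q)"
    then have "dotp u x = 0" if "x \<in> l" for x using that l by auto
    then show "u \<in> dual_point l" by (auto simp: dual_point_def dotp_def)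
  qed
  then show thesis using that n0 l by blast
qed

text \<open>\<open>cross u v\<close> spans the common point of the two lines, and its pairing with
  \<open>w\<close> is the determinant. Concurrency of lines thus becomes collinearity of dual
  points.\<close>

lemma inter_subset_iff_det3:
  assumes "{x. dotp u x = 0} \<noteq> {x. dotp v x = 0}" "u \<noteq> 0" "v \<noteq> 0"
  shows "{x. dotp u x = 0} \<inter> {x. dotp v x = 0} \<subseteq> {x. dotp w x = 0} \<longleftrightarrow> det3 u v w = 0"
proof -
  have n0: "cross u v \<noteq> 0"
  proof
    assume "cross u v = 0"
    then obtain t where t: "v = t *s u" using scaled_of_cross_eq_0 assms(2) by blast
    then have "t \<noteq> 0" using assms(3) by auto
    then show False using assms(1) t by auto
  qed
  have comm: "dotp x y = dotp y x" for x y by (simp add: dotp_3 mult.commute)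
  have "{x. dotp u x = 0} \<inter> {x. dotp v x = 0} = range (\<lambda>t. t *s cross u v)"
  proof (intro equalityI subsetI)
    fix x assume "x \<in> {x. dotp u x = 0} \<inter> {x. dotp v x = 0}"
    then have "dotp x u = 0" "dotp x v = 0" by (auto simp: comm)
    then obtain t where "x = t *s cross u v" using scaled_cross_of_orthogonal n0 by blast
    then show "x \<in> range (\<lambda>t. t *s cross u v)" by blast
  qed auto
  moreover have "range (\<lambda>t. t *s cross u v) \<subseteq> {x. dotp w x = 0} \<longleftrightarrow> dotp w (cross u v) = 0"
    by (auto simp: image_subset_iff dest: spec[of _ 1])
  ultimately show ?thesis by (simp add: det3_eq_dotp_cross comm)
qed

lemma proj_point_range:
  assumes "u \<noteq> 0"
  shows "proj_point (range (\<lambda>t. t *s u))"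
proof -
  have "vec.independent {u}" using assms by simp
  then have "vec.dim (vec.span {u}) = 1"
    by (simp add: vec.dim_span_eq_card_independent)
  then show ?thesis
    using vec.subspace_span[of "{u}"] by (simp add: proj_point_def vec.span_singleton)
qed

section \<open>Cubic forms and Chasles' theorem\<close>

text \<open>
  \<open>G u v\<close> is the derivative of \<open>F\<close> at \<open>u\<close> in direction \<open>v\<close>.
\<close>

definition cubic_form ::
  "(complex ^ 3 \<Rightarrow> complex) \<Rightarrow> (complex ^ 3 \<Rightarrow> complex ^ 3 \<Rightarrow> complex) \<Rightarrow> bool" where
  "cubic_form F G \<longleftrightarrow>
     (\<forall>u v s t. F (s *s u + t *s v) =
        s ^ 3 * F u + s\<^sup>2 * t * G u v + s * t\<^sup>2 * G v u + t ^ 3 * F v) \<and>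
     (\<forall>u v w s t. G u (s *s v + t *s w) = s * G u v + t * G u w)"

lemma cubic_form_expand:
  "cubic_form F G \<Longrightarrow> F (s *s u + t *s v) =
     s ^ 3 * F u + s\<^sup>2 * t * G u v + s * t\<^sup>2 * G v u + t ^ 3 * F v"
  by (simp add: cubic_form_def)

lemma cubic_form_linear:
  "cubic_form F G \<Longrightarrow> G u (s *s v + t *s w) = s * G u v + t * G u w"
  by (simp add: cubic_form_def)

lemma cubic_form_prod:
  assumes "\<And>s t x y. K (s *s x + t *s y) = s * K x + t * K y"
    and "\<And>s t x y. L (s *s x + t *s y) = s * L x + t * L y"
    and "\<And>s t x y. M (s *s x + t *s y) = s * M x + t * M y"
  shows "cubic_form (\<lambda>x. K x * L x * M x)
    (\<lambda>x y. K y * L x * M x + K x * L y * M x + K x * L x * M y)"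
  unfolding cubic_form_def
  by (simp only: assms) (simp add: power2_eq_square power3_eq_cube algebra_simps)

lemma cubic_form_diff_scaled:
  assumes "cubic_form F G" "cubic_form F' G'"
  shows "cubic_form (\<lambda>x. F x - k * F' x) (\<lambda>x y. G x y - k * G' x y)"
  unfolding cubic_form_def
proof (intro conjI allI)
  fix u v :: "complex ^ 3" and s t :: complex
  show "F (s *s u + t *s v) - k * F' (s *s u + t *s v) =
      s ^ 3 * (F u - k * F' u) + s\<^sup>2 * t * (G u v - k * G' u v)
      + s * t\<^sup>2 * (G v u - k * G' v u) + t ^ 3 * (F v - k * F' v)"
    by (simp only: assms[THEN cubic_form_expand]) (simp add: algebra_simps)
next
  fix u v w :: "complex ^ 3" and s t :: complex
  show "G u (s *s v + t *s w) - k * G' u (s *s v + t *s w) =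
      s * (G u v - k * G' u v) + t * (G u w - k * G' u w)"
    by (simp only: assms[THEN cubic_form_linear]) (simp add: algebra_simps)
qed

section \<open>Zeros of a cubic on a line\<close>

lemma cubic_form_eq_0_on_line:
  assumes "cubic_form F G" "F u = 0" "F v = 0" "G u v = 0" "G v u = 0"
  shows "F (s *s u + t *s v) = 0"
  using assms by (simp add: cubic_form_expand)

text \<open>With zeros at \<open>u\<close> and \<open>v\<close>, the restriction to their span is
  \<open>s * t * (s * G u v + t * G v u)\<close>. Two further, non-proportional zeros give two
  independent equations for the two coefficients.\<close>

lemma cubic_form_two_more_zeros:
  assumes cf: "cubic_form F G" and uv: "F u = 0" "F v = 0"
    and z: "F (x *s u + y *s v) = 0" "F (x' *s u + y' *s v) = 0"
    and nz: "x \<noteq> 0" "y \<noteq> 0" "x' \<noteq> 0" "y' \<noteq> 0" "x * y' \<noteq> x' * y"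
  shows "F (s *s u + t *s v) = 0"
proof -
  have "x * y * (x * G u v + y * G v u) = 0"
    using z(1) uv by (simp add: cubic_form_expand[OF cf] power2_eq_square algebra_simps)
  then have 1: "x * G u v + y * G v u = 0" using nz by simp
  have "x' * y' * (x' * G u v + y' * G v u) = 0"
    using z(2) uv by (simp add: cubic_form_expand[OF cf] power2_eq_square algebra_simps)
  then have 2: "x' * G u v + y' * G v u = 0" using nz by simp
  have "(x * y' - x' * y) * G u v = y' * (x * G u v + y * G v u) - y * (x' * G u v + y' * G v u)"
       "(x * y' - x' * y) * G v u = x * (x' * G u v + y' * G v u) - x' * (x * G u v + y * G v u)"
    by (simp_all add: algebra_simps)
  then have "G u v = 0" "G v u = 0" using 1 2 nz(5) by auto
  then show ?thesis using cubic_form_eq_0_on_line[OF cf uv] by blast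
qed

text \<open>\<open>G u v = 0\<close> makes \<open>u\<close> a double zero of the restriction to the
  line, so with \<open>v\<close> and the third point there are four zeros counted with
  multiplicity.\<close>

lemma cubic_form_double_zero:
  assumes cf: "cubic_form F G" and "F u = 0" "F v = 0" "G u v = 0"
    and "F (x *s u + y *s v) = 0" "x \<noteq> 0" "y \<noteq> 0"
  shows "F (s *s u + t *s v) = 0"
proof -
  have "x * y\<^sup>2 * G v u = 0"
    using assms(2-5) by (simp add: cubic_form_expand[OF cf])
  then have "G v u = 0" using assms by simp
  then show ?thesis using cubic_form_eq_0_on_line[OF cf] assms by blast
qed

lemma cubic_form_derivative_eq_0_on_line:
  assumes cf: "cubic_form F G" and z: "\<And>s t. F (s *s u + t *s v) = 0"
  shows "G u v = 0"
proof -
  have "F u = 0" "F v = 0" using z[of 1 0] z[of 0 1] by simp_all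
  then show ?thesis
    using z[of 1 1] z[of 1 "-1"] cubic_form_expand[OF cf, of 1 u 1 v] cubic_form_expand[OF cf, of 1 u "-1" v]
    by simp
qed

text \<open>Allows \<open>cubic_diff\<close> of a product of linear forms to be computed by the
  product rule.\<close>

lemma cubic_form_derivative_unique:
  assumes "cubic_form F G" "cubic_form F H"
  shows "G = H"
proof (intro ext)
  fix u v
  have "G u v + G v u = H u v + H v u" "G v u - G u v = H v u - H u v"
    using cubic_form_expand[OF assms(1), of 1 u 1 v] cubic_form_expand[OF assms(1), of 1 u "-1" v]
      cubic_form_expand[OF assms(2), of 1 u 1 v] cubic_form_expand[OF assms(2), of 1 u "-1" v]
    by simp_all
  then have "2 * G u v = 2 * H u v" by algebra
  then show "G u v = H u v" by simp
qed

text \<open>If \<open>p\<close> is off the line through \<open>u\<close> and \<open>b 0\<close>, the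
  line joining \<open>p\<close> and \<open>b 0\<close> meets the four given lines in four distinct
  points, hence carries four zeros of the cubic.\<close>

lemma cubic_form_eq_0_of_four_concurrent_lines:
  assumes cf: "cubic_form F G"
    and z: "\<And>j s t. j < (4::nat) \<Longrightarrow> F (s *s u + t *s b j) = 0"
    and nz: "\<And>i j. i < 4 \<Longrightarrow> j < 4 \<Longrightarrow> i \<noteq> j \<Longrightarrow> det3 u (b i) (b j) \<noteq> 0"
  shows "F p = 0"
proof (cases "det3 u (b 0) p = 0")
  case True
  then obtain s t where "p = s *s u + t *s b 0"
    using span_of_det3_eq_0 nz[of 0 1] by (metis zero_less_numeral one_less_numeral_iff zero_neq_one semiring_norm(76))
  then show ?thesis using z[of 0] by simp
next
  case False
  define x where "x i = det3 u (b i) (b 0)" for i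
  define y where "y i = - det3 u (b i) p" for i
  have x: "x i \<noteq> 0" if "0 < i" "i < 4" for i
    using nz[of i 0] that by (simp add: x_def)
  have F0: "F (b 0) = 0" using z[of 0 0 1] by simp
  \<comment> \<open>The line joining \<open>p\<close> and \<open>b 0\<close> meets the line joining \<open>u\<close> and \<open>b i\<close> in \<open>x i p + y i (b 0)\<close>.\<close>
  have q: "(x i)\<^sup>2 * F p + x i * y i * G p (b 0) + (y i)\<^sup>2 * G (b 0) p = 0"
    if i: "0 < i" "i < 4" for i
  proof -
    have "det3 u (b i) (x i *s p + y i *s b 0) = 0"
      by (simp only: det3_linear) (simp add: x_def y_def)
    moreover have "det3 u (b i) (b 0) \<noteq> 0" using x[OF i] by (simp add: x_def)
    ultimately obtain s t where "x i *s p + y i *s b 0 = s *s u + t *s b i"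
      by (rule span_of_det3_eq_0)
    then have "F (x i *s p + y i *s b 0) = 0" using z i by simp
    then have "x i * ((x i)\<^sup>2 * F p + x i * y i * G p (b 0) + (y i)\<^sup>2 * G (b 0) p) = 0"
      using F0 by (simp add: cubic_form_expand[OF cf] power2_eq_square power3_eq_cube algebra_simps)
    then show ?thesis using x[OF i] by simp
  qed
  have d: "x i * y j - x j * y i \<noteq> 0" if "0 < i" "i < 4" "0 < j" "j < 4" "i \<noteq> j" for i j
  proof -
    \<comment> \<open>A Pluecker relation. It shows that the intersection points on the line through
      \<open>p\<close> and \<open>b 0\<close> are pairwise distinct.\<close>
    have "x i * y j - x j * y i = - (det3 u (b i) (b j) * det3 u (b 0) p)"
      unfolding x_def y_def det3_def by (simp add: algebra_simps)
    then show ?thesis using nz that False by simp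
  qed
  \<comment> \<open>The three equations \<open>q\<close> are linear in \<open>F p\<close>,
    \<open>G p (b 0)\<close> and \<open>G (b 0) p\<close>; the factor of \<open>F p\<close> is their
    homogeneous Vandermonde determinant.\<close>
  have "(x 1 * y 2 - x 2 * y 1) * (x 1 * y 3 - x 3 * y 1) * (x 2 * y 3 - x 3 * y 2) * F p = 0"
    using q[of 1] q[of 2] q[of 3] by simp algebra
  then show ?thesis using d[of 1 2] d[of 1 3] d[of 2 3] by simp
qed

text \<open>The product of the column lines is another cubic through all nine points, which leaves a
  multiple free to adjust. Condition \<open>n1\<close> keeps the second row and \<open>p31\<close>,
  \<open>p32\<close> off the first row, \<open>n2\<close> keeps \<open>p31\<close>,
  \<open>p32\<close> off the second, and \<open>n3\<close> separates points within a row.\<close>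

lemma chasles:
  assumes cf: "cubic_form F G"
    and rows: "det3 p11 p12 p13 = 0" "det3 p21 p22 p23 = 0" "det3 p31 p32 p33 = 0"
    and cols: "det3 p11 p21 p31 = 0" "det3 p12 p22 p32 = 0" "det3 p13 p23 p33 = 0"
    and n1: "det3 p11 p12 p21 \<noteq> 0" "det3 p11 p12 p22 \<noteq> 0" "det3 p11 p12 p23 \<noteq> 0"
      "det3 p11 p12 p31 \<noteq> 0" "det3 p11 p12 p32 \<noteq> 0"
    and n2: "det3 p21 p22 p31 \<noteq> 0" "det3 p21 p22 p32 \<noteq> 0"
    and n3: "det3 p11 p13 p23 \<noteq> 0" "det3 p12 p13 p23 \<noteq> 0"
      "det3 p21 p23 p11 \<noteq> 0" "det3 p22 p23 p11 \<noteq> 0" "det3 p31 p32 p11 \<noteq> 0"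
    and z: "F p11 = 0" "F p12 = 0" "F p13 = 0" "F p21 = 0" "F p22 = 0" "F p23 = 0"
      "F p31 = 0" "F p32 = 0"
  shows "F p33 = 0"
proof -
  obtain \<alpha> \<beta> where p13: "p13 = \<alpha> *s p11 + \<beta> *s p12"
    using span_of_det3_eq_0[OF rows(1) n1(1)] .
  obtain \<gamma> \<delta> where p23: "p23 = \<gamma> *s p21 + \<delta> *s p22"
    using span_of_det3_eq_0[OF rows(2) n2(1)] .
  obtain \<epsilon> \<zeta> where p33: "p33 = \<epsilon> *s p31 + \<zeta> *s p32"
    using span_of_det3_eq_0[OF rows(3) n3(5)] .
  have ab: "\<alpha> \<noteq> 0" "\<beta> \<noteq> 0" using n3(1,2) p13 by (auto simp: det3_def algebra_simps)
  have cd: "\<gamma> \<noteq> 0" "\<delta> \<noteq> 0" using n3(3,4) p23 by (auto simp: det3_def algebra_simps)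
  define M where "M x = det3 p11 p21 x * det3 p12 p22 x * det3 p13 p23 x" for x
  define N where "N x y = det3 p11 p21 y * det3 p12 p22 x * det3 p13 p23 x
     + det3 p11 p21 x * det3 p12 p22 y * det3 p13 p23 x
     + det3 p11 p21 x * det3 p12 p22 x * det3 p13 p23 y" for x y
  have cfM: "cubic_form M N"
    unfolding M_def N_def by (rule cubic_form_prod) (simp_all only: det3_linear)
  \<comment> \<open>The harmonic conjugate of \<open>p13\<close> with respect to \<open>p11\<close>
    and \<open>p12\<close>: a fourth point of the first row, lying on none of the columns.\<close>
  define q where "q = \<alpha> *s p11 + (- \<beta>) *s p12"
  have "M q \<noteq> 0"
  proof -
    have "det3 p11 p21 q = \<beta> * det3 p11 p12 p21" "det3 p12 p22 q = \<alpha> * det3 p11 p12 p22"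
      "det3 p13 p23 q = 2 * \<alpha> * \<beta> * det3 p11 p12 p23"
      unfolding q_def p13 by (simp_all add: det3_def algebra_simps)
    then show ?thesis using ab n1 by (simp add: M_def)
  qed
  \<comment> \<open>Subtracting a multiple of the product of the columns produces a fourth zero on the first row;
    the remaining cubic then vanishes on each row in turn.\<close>
  define F' where "F' x = F x - (F q / M q) * M x" for x
  define G' where "G' x y = G x y - (F q / M q) * N x y" for x y
  have cf': "cubic_form F' G'"
    unfolding F'_def G'_def by (rule cubic_form_diff_scaled[OF cf cfM])
  have M0: "M p11 = 0" "M p12 = 0" "M p13 = 0" "M p21 = 0" "M p22 = 0" "M p23 = 0"
    "M p31 = 0" "M p32 = 0" "M p33 = 0"
    using cols by (simp_all add: M_def)
  have z': "F' p11 = 0" "F' p12 = 0" "F' p13 = 0" "F' p21 = 0" "F' p22 = 0" "F' p23 = 0"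
    "F' p31 = 0" "F' p32 = 0" "F' q = 0"
    using z M0 \<open>M q \<noteq> 0\<close> by (simp_all add: F'_def)
  have "F' (s *s p11 + t *s p12) = 0" for s t
    by (rule cubic_form_two_more_zeros[OF cf' z'(1,2) z'(3)[unfolded p13] z'(9)[unfolded q_def]])
      (use ab in simp_all)
  then have l1: "F' x = 0" if "det3 p11 p12 x = 0" for x
    using span_of_det3_eq_0[OF that n1(1)] by metis
  have "F' (s *s p21 + t *s p22) = 0" for s t
  proof (rule cubic_form_two_more_zeros[OF cf' z'(4,5) z'(6)[unfolded p23]])
    \<comment> \<open>The fourth zero on the second row is its intersection with the first row; it
      differs from \<open>p23\<close>, which is off the first row.\<close>
    show "F' (det3 p11 p12 p22 *s p21 + (- det3 p11 p12 p21) *s p22) = 0"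
      by (rule l1) (simp only: det3_linear, simp)
    have "\<gamma> * det3 p11 p12 p21 + \<delta> * det3 p11 p12 p22 \<noteq> 0"
      using n1(3) unfolding p23 det3_linear .
    moreover have "\<gamma> * det3 p11 p12 p21 + \<delta> * det3 p11 p12 p22 = 0"
      if "\<gamma> * - det3 p11 p12 p21 = det3 p11 p12 p22 * \<delta>" using that by algebra
    ultimately show "\<gamma> * - det3 p11 p12 p21 \<noteq> det3 p11 p12 p22 * \<delta>" by blast
  qed (use cd n1 in simp_all)
  then have l2: "F' x = 0" if "det3 p21 p22 x = 0" for x
    using span_of_det3_eq_0[OF that n2(1)] by metis
  \<comment> \<open>The intersections of the third row with the first and the second row. If they
    differ, they join \<open>p31\<close> and \<open>p32\<close> to give four zeros.\<close>
  define O1 where "O1 = det3 p11 p12 p32 *s p31 + (- det3 p11 p12 p31) *s p32"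
  define O2 where "O2 = det3 p21 p22 p32 *s p31 + (- det3 p21 p22 p31) *s p32"
  have O1: "det3 p11 p12 O1 = 0" unfolding O1_def by (simp only: det3_linear) simp
  have O2: "det3 p21 p22 O2 = 0" unfolding O2_def by (simp only: det3_linear) simp
  have l3: "F' (s *s p31 + t *s p32) = 0" for s t
  proof (cases "det3 p11 p12 p32 * - det3 p21 p22 p31 = det3 p21 p22 p32 * - det3 p11 p12 p31")
    case False
    then show ?thesis
      using cubic_form_two_more_zeros[OF cf' z'(7,8) l1[OF O1, unfolded O1_def] l2[OF O2, unfolded O2_def]] n1 n2
      by simp
  next
    case True
    have O1': "det3 p21 p22 O1 = 0"
      using True unfolding O1_def by (simp only: det3_linear) (simp add: algebra_simps)
    \<comment> \<open>The three rows are concurrent, and \<open>F'\<close> is singular at their common point.\<close>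
    have g1: "G' O1 x = 0" if "det3 p11 p12 x = 0" for x
      by (rule cubic_form_derivative_eq_0_on_line[OF cf'], rule l1)
        (simp only: det3_linear O1 that, simp)
    have g2: "G' O1 x = 0" if "det3 p21 p22 x = 0" for x
      by (rule cubic_form_derivative_eq_0_on_line[OF cf'], rule l2)
        (simp only: det3_linear O1' that, simp)
    \<comment> \<open>\<open>k\<close> is chosen so that \<open>p31\<close> minus \<open>k\<close>
      times \<open>p21\<close> lies on the first row. As \<open>p21\<close> lies on the second row,
      \<open>p31\<close> is a sum of two directions in which the derivative at \<open>O1\<close>
      vanishes.\<close>
    define k where "k = det3 p11 p12 p31 / det3 p11 p12 p21"
    have "det3 p11 p12 (1 *s p31 + (- k) *s p21) = 0"
      using n1(1) by (simp only: det3_linear) (simp add: k_def)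
    then have "G' O1 (1 *s p31 + (- k) *s p21) = 0" by (rule g1)
    moreover have "G' O1 p21 = 0" by (rule g2) simp
    ultimately have g: "G' O1 p31 = 0"
      by (simp only: cubic_form_linear[OF cf']) simp
    \<comment> \<open>The definition of \<open>O1\<close>, solved for \<open>p32\<close>. On the
      third row \<open>O1\<close> is then a double zero, and \<open>p31\<close> and
      \<open>p32\<close> are two more.\<close>
    define x y where "x = - 1 / det3 p11 p12 p31" and "y = det3 p11 p12 p32 / det3 p11 p12 p31"
    have xy: "x \<noteq> 0" "y \<noteq> 0" using n1 by (simp_all add: x_def y_def)
    have p32: "p32 = x *s O1 + y *s p31"
      using n1(4) unfolding O1_def x_def y_def by (simp add: vec_eq_iff field_simps)
    have "F' (s *s O1 + t *s p31) = 0" for s t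
      by (rule cubic_form_double_zero[OF cf' l1[OF O1] z'(7) g z'(8)[unfolded p32] xy])
    moreover have "s *s p31 + t *s p32 = (t * x) *s O1 + (s + t * y) *s p31"
      unfolding p32 by (simp add: vec_eq_iff algebra_simps)
    ultimately show ?thesis by (simp only:)
  qed
  have "F' p33 = 0" unfolding p33 by (rule l3)
  then show ?thesis using M0(9) by (simp add: F'_def)
qed

section \<open>Ternary cubics by coefficients\<close>

definition exponent :: "nat \<Rightarrow> nat \<Rightarrow> nat \<Rightarrow> 3 \<Rightarrow> nat" where
  "exponent i j k = (\<lambda>n. if n = 1 then i else if n = 2 then j else k)"

lemma exponent_simps [simp]:
  "exponent i j k 1 = i" "exponent i j k 2 = j" "exponent i j k 3 = k"
  by (simp_all add: exponent_def)

lemma exponent_eq_iff [simp]: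
  "exponent i j k = exponent i' j' k' \<longleftrightarrow> i = i' \<and> j = j' \<and> k = k'"
  by (metis exponent_simps)

lemma cubic_exponents_eq:
  "cubic_exponents = {exponent 3 0 0, exponent 0 3 0, exponent 0 0 3,
     exponent 2 1 0, exponent 2 0 1, exponent 1 2 0, exponent 0 2 1,
     exponent 1 0 2, exponent 0 1 2, exponent 1 1 1}" (is "_ = ?E")
proof (intro equalityI subsetI)
  fix e assume "e \<in> cubic_exponents"
  then have s: "e 1 + e 2 + e 3 = 3" by (simp add: cubic_exponents_def sum_3)
  have e: "e = exponent (e 1) (e 2) (e 3)" by (auto simp: fun_eq_iff forall_3)
  obtain i j k where ijk: "e 1 = i" "e 2 = j" "e 3 = k" by blast
  have "i = 0 \<or> i = 1 \<or> i = 2 \<or> i = 3" "j = 0 \<or> j = 1 \<or> j = 2 \<or> j = 3" "k = 3 - i - j" "i + j \<le> 3"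
    using s ijk by auto
  then have "exponent i j k \<in> ?E" by (elim disjE) simp_all
  then show "e \<in> ?E" using e ijk by simp
qed (auto simp: cubic_exponents_def sum_3)

lemma card_cubic_exponents: "card cubic_exponents = 10"
  by (simp add: cubic_exponents_eq)

lemma finite_cubic_exponents: "finite cubic_exponents"
  by (simp add: cubic_exponents_eq)

lemma sum_cubic_exponents:
  fixes f :: "(3 \<Rightarrow> nat) \<Rightarrow> complex"
  shows "(\<Sum>e\<in>cubic_exponents. f e) = f (exponent 3 0 0) + f (exponent 0 3 0) + f (exponent 0 0 3)
    + f (exponent 2 1 0) + f (exponent 2 0 1) + f (exponent 1 2 0) + f (exponent 0 2 1)
    + f (exponent 1 0 2) + f (exponent 0 1 2) + f (exponent 1 1 1)"
  by (simp add: cubic_exponents_eq)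

lemma prod_UNIV_3: "(\<Prod>j\<in>UNIV. f j) = f 1 * f 2 * f (3 :: 3)"
  for f :: "3 \<Rightarrow> complex"
  unfolding UNIV_3 by (simp add: mult.assoc)

lemma cubic_eval_expand:
  "cubic_eval c x = c (exponent 3 0 0) * x $ 1 ^ 3 + c (exponent 0 3 0) * x $ 2 ^ 3
     + c (exponent 0 0 3) * x $ 3 ^ 3
     + c (exponent 2 1 0) * x $ 1 ^ 2 * x $ 2 + c (exponent 2 0 1) * x $ 1 ^ 2 * x $ 3
     + c (exponent 1 2 0) * x $ 1 * x $ 2 ^ 2 + c (exponent 0 2 1) * x $ 2 ^ 2 * x $ 3
     + c (exponent 1 0 2) * x $ 1 * x $ 3 ^ 2 + c (exponent 0 1 2) * x $ 2 * x $ 3 ^ 2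
     + c (exponent 1 1 1) * x $ 1 * x $ 2 * x $ 3"
  unfolding cubic_eval_def sum_cubic_exponents prod_UNIV_3 exponent_simps
  by (simp only: power_0 power_one_right mult_1_left mult_1_right mult.assoc)

lemma cubic_partial_expand:
  "cubic_partial 1 c x = 3 * c (exponent 3 0 0) * x $ 1 ^ 2
     + 2 * c (exponent 2 1 0) * x $ 1 * x $ 2 + 2 * c (exponent 2 0 1) * x $ 1 * x $ 3
     + c (exponent 1 2 0) * x $ 2 ^ 2 + c (exponent 1 0 2) * x $ 3 ^ 2
     + c (exponent 1 1 1) * x $ 2 * x $ 3"
  "cubic_partial 2 c x = 3 * c (exponent 0 3 0) * x $ 2 ^ 2
     + c (exponent 2 1 0) * x $ 1 ^ 2 + 2 * c (exponent 1 2 0) * x $ 1 * x $ 2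
     + 2 * c (exponent 0 2 1) * x $ 2 * x $ 3 + c (exponent 0 1 2) * x $ 3 ^ 2
     + c (exponent 1 1 1) * x $ 1 * x $ 3"
  "cubic_partial 3 c x = 3 * c (exponent 0 0 3) * x $ 3 ^ 2
     + c (exponent 2 0 1) * x $ 1 ^ 2 + c (exponent 0 2 1) * x $ 2 ^ 2
     + 2 * c (exponent 1 0 2) * x $ 1 * x $ 3 + 2 * c (exponent 0 1 2) * x $ 2 * x $ 3
     + c (exponent 1 1 1) * x $ 1 * x $ 2"
  unfolding cubic_partial_def sum_cubic_exponents prod_UNIV_3 exponent_simps
  by (simp_all add: ac_simps)

definition cubic_diff :: "((3 \<Rightarrow> nat) \<Rightarrow> complex) \<Rightarrow> complex ^ 3 \<Rightarrow> complex ^ 3 \<Rightarrow> complex" where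
  "cubic_diff c u v = (\<Sum>i\<in>UNIV. v $ i * cubic_partial i c u)"

text \<open>Taylor expansion along a line. It makes the results on \<open>cubic_form\<close>
  available for cubics given by coefficients.\<close>

lemma cubic_form_cubic_eval: "cubic_form (cubic_eval c) (cubic_diff c)"
  unfolding cubic_form_def
proof (intro conjI allI)
  fix u v :: "complex ^ 3" and s t :: complex
  show "cubic_eval c (s *s u + t *s v) = s ^ 3 * cubic_eval c u + s\<^sup>2 * t * cubic_diff c u v
      + s * t\<^sup>2 * cubic_diff c v u + t ^ 3 * cubic_eval c v"
    unfolding cubic_diff_def sum_3 cubic_partial_expand cubic_eval_expand
      vector_add_component vector_smult_component
    by (simp add: power2_eq_square power3_eq_cube algebra_simps)
qed (simp add: cubic_diff_def sum_3 algebra_simps)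

text \<open>The unit vectors isolate the pure cubes, vectors with two nonzero entries
  \<open>1\<close> and \<open>1\<close> or \<open>-1\<close> separate the pairs of mixed terms, and
  the vector with all entries \<open>1\<close> leaves the last coefficient.\<close>

lemma cubic_eval_neq_0_of_nonzero:
  assumes "cubic_nonzero c"
  obtains x where "cubic_eval c x \<noteq> 0"
proof (rule ccontr)
  assume "\<not> thesis"
  then have z: "cubic_eval c (vector [x, y, z]) = 0" for x y z using that by blast
  note E = z[unfolded cubic_eval_expand vector_3]
  have 1: "c (exponent 3 0 0) = 0" "c (exponent 0 3 0) = 0" "c (exponent 0 0 3) = 0"
    using E[of 1 0 0] E[of 0 1 0] E[of 0 0 1] by simp_all
  have *: "p = 0 \<and> q = 0" if "p + q = 0" "q - p = 0" for p q :: complex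
    using that by auto
  have 2: "c (exponent 2 1 0) = 0" "c (exponent 1 2 0) = 0"
    using *[of "c (exponent 2 1 0)" "c (exponent 1 2 0)"] E[of 1 1 0] E[of 1 "-1" 0] 1 by simp_all
  have 3: "c (exponent 2 0 1) = 0" "c (exponent 1 0 2) = 0"
    using *[of "c (exponent 2 0 1)" "c (exponent 1 0 2)"] E[of 1 0 1] E[of 1 0 "-1"] 1 by simp_all
  have 4: "c (exponent 0 2 1) = 0" "c (exponent 0 1 2) = 0"
    using *[of "c (exponent 0 2 1)" "c (exponent 0 1 2)"] E[of 0 1 1] E[of 0 1 "-1"] 1 by simp_all
  have "c (exponent 1 1 1) = 0" using E[of 1 1 1] 1 2 3 4 by simp
  then show False using assms 1 2 3 4 by (auto simp: cubic_nonzero_def cubic_exponents_eq)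
qed

text \<open>Provides unions of three lines as cubics. The coefficients come from multiplying out;
  the last branch serves \<open>exponent 1 1 1\<close>.\<close>

lemma exists_cubic_eval_eq_prod:
  obtains c where "\<And>x. cubic_eval c x = dotp u x * dotp v x * dotp w x"
proof -
  define c where "c e = (
     if e = exponent 3 0 0 then u $ 1 * v $ 1 * w $ 1 else
     if e = exponent 0 3 0 then u $ 2 * v $ 2 * w $ 2 else
     if e = exponent 0 0 3 then u $ 3 * v $ 3 * w $ 3 else
     if e = exponent 2 1 0 then u $ 2 * v $ 1 * w $ 1 + u $ 1 * v $ 2 * w $ 1 + u $ 1 * v $ 1 * w $ 2 else
     if e = exponent 2 0 1 then u $ 3 * v $ 1 * w $ 1 + u $ 1 * v $ 3 * w $ 1 + u $ 1 * v $ 1 * w $ 3 else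
     if e = exponent 1 2 0 then u $ 1 * v $ 2 * w $ 2 + u $ 2 * v $ 1 * w $ 2 + u $ 2 * v $ 2 * w $ 1 else
     if e = exponent 0 2 1 then u $ 3 * v $ 2 * w $ 2 + u $ 2 * v $ 3 * w $ 2 + u $ 2 * v $ 2 * w $ 3 else
     if e = exponent 1 0 2 then u $ 1 * v $ 3 * w $ 3 + u $ 3 * v $ 1 * w $ 3 + u $ 3 * v $ 3 * w $ 1 else
     if e = exponent 0 1 2 then u $ 2 * v $ 3 * w $ 3 + u $ 3 * v $ 2 * w $ 3 + u $ 3 * v $ 3 * w $ 2 else
     u $ 1 * v $ 2 * w $ 3 + u $ 1 * v $ 3 * w $ 2 + u $ 2 * v $ 1 * w $ 3
     + u $ 2 * v $ 3 * w $ 1 + u $ 3 * v $ 1 * w $ 2 + u $ 3 * v $ 2 * w $ 1)" for e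
  have "cubic_eval c x = dotp u x * dotp v x * dotp w x" for x
    unfolding cubic_eval_expand dotp_3
    by (simp add: c_def power2_eq_square power3_eq_cube algebra_simps)
  then show thesis by (rule that)
qed

section \<open>Linear systems and cubics through nine points\<close>

text \<open>Gaussian elimination, by induction on the number of equations: a nonzero entry
  \<open>f n p\<close> of the last equation serves as pivot to eliminate the unknown
  \<open>p\<close>.\<close>

lemma homogeneous_system_solution:
  fixes f :: "nat \<Rightarrow> 'a \<Rightarrow> 'b :: field"
  assumes "finite I" "n < card I"
  shows "\<exists>c. (\<exists>i\<in>I. c i \<noteq> 0) \<and> (\<forall>j<n. (\<Sum>i\<in>I. c i * f j i) = 0)"
  using assms
proof (induction n arbitrary: I f)
  case 0
  then show ?case by (auto intro!: exI[of _ "\<lambda>_. 1"] simp: card_gt_0_iff)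
next
  case (Suc n)
  show ?case
  proof (cases "\<forall>i\<in>I. f n i = 0")
    case True
    obtain c where "\<exists>i\<in>I. c i \<noteq> 0" "\<forall>j<n. (\<Sum>i\<in>I. c i * f j i) = 0"
      using Suc.IH[of I f] Suc.prems by auto
    then show ?thesis using True by (intro exI[of _ c]) (auto simp: less_Suc_eq)
  next
    case False
    then obtain p where p: "p \<in> I" "f n p \<noteq> 0" by blast
    define J where "J = I - {p}"
    have J: "finite J" "n < card J" "p \<notin> J" "I = insert p J"
      using Suc.prems p by (auto simp: J_def)
    obtain c where c: "\<exists>i\<in>J. c i \<noteq> 0"
        "\<And>j. j < n \<Longrightarrow> (\<Sum>i\<in>J. c i * (f j i - f j p * f n i / f n p)) = 0"
      using Suc.IH[OF J(1,2), of "\<lambda>j i. f j i - f j p * f n i / f n p"] by blast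
    define S where "S = (\<Sum>i\<in>J. c i * f n i)"
    \<comment> \<open>The value at \<open>p\<close> is the one that solves equation
      \<open>n\<close>.\<close>
    define d where "d = c(p := - S / f n p)"
    have d: "(\<Sum>i\<in>I. d i * f j i) = (\<Sum>i\<in>J. c i * f j i) - S / f n p * f j p" for j
    proof -
      have "(\<Sum>i\<in>J. d i * f j i) = (\<Sum>i\<in>J. c i * f j i)"
        using J(3) by (intro sum.cong) (auto simp: d_def)
      then show ?thesis using J by (simp add: d_def)
    qed
    have "(\<Sum>i\<in>I. d i * f j i) = 0" if "j < Suc n" for j
    proof (cases "j = n")
      case True
      then show ?thesis using p by (simp add: d S_def)
    next
      case False
      then have "(\<Sum>i\<in>J. c i * (f j i - f j p * f n i / f n p)) = 0" using that c(2) by simp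
      moreover have "(\<Sum>i\<in>J. c i * (f j i - f j p * f n i / f n p))
          = (\<Sum>i\<in>J. c i * f j i) - S / f n p * f j p"
        by (simp add: S_def sum_subtractf sum_distrib_left sum_distrib_right sum_divide_distrib
            right_diff_distrib mult_ac)
      ultimately show ?thesis by (simp add: d)
    qed
    moreover have "\<exists>i\<in>I. d i \<noteq> 0" using c(1) J(3,4) by (auto simp: d_def)
    ultimately show ?thesis by blast
  qed
qed

text \<open>There are ten coefficients, and each point imposes one homogeneous linear condition on
  them.\<close>

lemma exists_cubic_through_nine_points:
  assumes "length ps = 9"
  obtains c where "cubic_nonzero c" "\<And>p. p \<in> set ps \<Longrightarrow> cubic_eval c p = 0"
proof -
  obtain c where "\<exists>e\<in>cubic_exponents. c e \<noteq> 0"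
      "\<forall>j<9. (\<Sum>e\<in>cubic_exponents. c e * (\<Prod>i\<in>UNIV. (ps ! j) $ i ^ e i)) = 0"
    using homogeneous_system_solution[OF finite_cubic_exponents, of 9
        "\<lambda>j e. \<Prod>i\<in>UNIV. (ps ! j) $ i ^ e i"] card_cubic_exponents by auto
  then show thesis
    using assms by (intro that[of c]) (auto simp: cubic_nonzero_def cubic_eval_def in_set_conv_nth)
qed

section \<open>Cyclic nets\<close>

text \<open>Regularity at a single representing vector, phrased with directional derivatives to fit
  \<open>cubic_form\<close>; \<open>range_in_regular_points\<close> passes to the projective
  point.\<close>

definition cubic_regular_at :: "((3 \<Rightarrow> nat) \<Rightarrow> complex) \<Rightarrow> complex ^ 3 \<Rightarrow> bool" where
  "cubic_regular_at k u \<longleftrightarrow> cubic_eval k u = 0 \<and> (\<exists>v. cubic_diff k u v \<noteq> 0)"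

lemma range_in_regular_points:
  assumes "u \<noteq> 0" "cubic_regular_at k u"
  shows "range (\<lambda>t. t *s u) \<in> regular_points k"
proof -
  note cf = cubic_form_cubic_eval[of k]
  have F: "cubic_eval k (t *s u) = 0" for t
    using cubic_form_expand[OF cf, of t u 0 u] assms(2) by (simp add: cubic_regular_at_def)
  obtain v where v: "cubic_diff k u v \<noteq> 0" using assms(2) by (auto simp: cubic_regular_at_def)
  have "\<exists>i. cubic_partial i k (t *s u) \<noteq> 0" if "t \<noteq> 0" for t
  proof (rule ccontr)
    assume "\<nexists>i. cubic_partial i k (t *s u) \<noteq> 0"
    then have 0: "cubic_diff k (t *s u) w = 0" for w by (simp add: cubic_diff_def)
    \<comment> \<open>The same difference is expanded in \<open>u\<close>, \<open>v\<close> and in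
      \<open>t *s u\<close>, \<open>v\<close>; comparison gives homogeneity of degree 2 of the
      derivative in its base point.\<close>
    have "cubic_eval k (t *s u + 1 *s v) - cubic_eval k (t *s u + (- 1) *s v)
        = 2 * t\<^sup>2 * cubic_diff k u v + 2 * cubic_eval k v"
      by (simp only: cubic_form_expand[OF cf]) (simp add: algebra_simps)
    moreover have "cubic_eval k (1 *s (t *s u) + 1 *s v) - cubic_eval k (1 *s (t *s u) + (- 1) *s v)
        = 2 * cubic_diff k (t *s u) v + 2 * cubic_eval k v"
      by (simp only: cubic_form_expand[OF cf]) (simp add: algebra_simps)
    ultimately have "2 * t\<^sup>2 * cubic_diff k u v = 0" using 0 by simp
    then show False using v that by simp
  qed
  then show ?thesis
    using F proj_point_range[OF assms(1)] by (auto simp: regular_points_def cubic_curve_def)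
qed

lemma cubic_nonzero_of_regular_at: "cubic_regular_at k u \<Longrightarrow> cubic_nonzero k"
  by (rule ccontr) (auto simp: cubic_regular_at_def cubic_nonzero_def cubic_diff_def cubic_partial_def)

text \<open>At a point on exactly one of the three lines only one term of the product rule survives,
  and it is nonzero in a direction where that linear form is nonzero. The vectors \<open>x\<close>,
  \<open>y\<close>, \<open>z\<close> supply such directions.\<close>

lemma cubic_regular_at_prod:
  assumes k: "\<And>x. cubic_eval k x = K x * L x * M x"
    and lin: "\<And>s t x y. K (s *s x + t *s y) = s * K x + t * K y"
      "\<And>s t x y. L (s *s x + t *s y) = s * L x + t * L y"
      "\<And>s t x y. M (s *s x + t *s y) = s * M x + t * M y"
    and ne: "K x \<noteq> 0" "L y \<noteq> 0" "M z \<noteq> 0"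
    and p: "K p = 0 \<and> L p \<noteq> 0 \<and> M p \<noteq> 0 \<or> K p \<noteq> 0 \<and> L p = 0 \<and> M p \<noteq> 0
      \<or> K p \<noteq> 0 \<and> L p \<noteq> 0 \<and> M p = 0"
  shows "cubic_regular_at k p"
proof -
  have "cubic_form (cubic_eval k) (\<lambda>x y. K y * L x * M x + K x * L y * M x + K x * L x * M y)"
    using cubic_form_prod[of K L M, OF lin] k by (simp add: k[abs_def])
  then have "cubic_diff k = (\<lambda>x y. K y * L x * M x + K x * L y * M x + K x * L x * M y)"
    using cubic_form_derivative_unique cubic_form_cubic_eval by blast
  then have "cubic_diff k p x \<noteq> 0 \<or> cubic_diff k p y \<noteq> 0 \<or> cubic_diff k p z \<noteq> 0"
    using p ne by auto
  then show ?thesis using p k by (auto simp: cubic_regular_at_def)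
qed

text \<open>
  Dual vectors of the lines of a net realizing the cyclic group of order \<open>m\<close>. The third class is
  indexed by the negated group element, which makes the conditions symmetric in the three classes.
\<close>

locale cyclic_net =
  fixes m :: int and a b c :: "int \<Rightarrow> complex ^ 3"
  assumes period: "m dvd i - j \<Longrightarrow> a i = a j" "m dvd i - j \<Longrightarrow> b i = b j" "m dvd i - j \<Longrightarrow> c i = c j"
    and abc: "det3 (a i) (b j) (c k) = 0 \<longleftrightarrow> m dvd i + j + k"
    and aab: "det3 (a i) (a j) (b k) = 0 \<longleftrightarrow> m dvd i - j"
    and aac: "det3 (a i) (a j) (c k) = 0 \<longleftrightarrow> m dvd i - j"
    and bba: "det3 (b i) (b j) (a k) = 0 \<longleftrightarrow> m dvd i - j"
    and bbc: "det3 (b i) (b j) (c k) = 0 \<longleftrightarrow> m dvd i - j"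
    and cca: "det3 (c i) (c j) (a k) = 0 \<longleftrightarrow> m dvd i - j"
    and ccb: "det3 (c i) (c j) (b k) = 0 \<longleftrightarrow> m dvd i - j"

text \<open>By this symmetry a result about one class carries over to the other two.\<close>

lemma cyclic_net_rotate:
  assumes "cyclic_net m a b c"
  shows "cyclic_net m b c a"
proof -
  interpret cyclic_net m a b c by fact
  have bca: "det3 (b i) (c j) (a k) = 0 \<longleftrightarrow> m dvd i + j + k" for i j k
    using abc[of k i j] det3_rotate[of "b i" "c j" "a k"] by (simp add: ac_simps)
  show ?thesis
    by unfold_locales (erule period | rule bca aab aac bba bbc cca ccb)+
qed

section \<open>Sliding grids along the net\<close>

context cyclic_net
begin

lemma det_perms:
  "det3 (b i) (c j) (a k) = 0 \<longleftrightarrow> m dvd i + j + k"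
  "det3 (c i) (a j) (b k) = 0 \<longleftrightarrow> m dvd i + j + k"
  "det3 (a i) (b j) (b k) = 0 \<longleftrightarrow> m dvd j - k"
  "det3 (b i) (c j) (c k) = 0 \<longleftrightarrow> m dvd j - k"
  "det3 (c i) (a j) (a k) = 0 \<longleftrightarrow> m dvd j - k"
  "det3 (b i) (a j) (a k) = 0 \<longleftrightarrow> m dvd j - k"
  "det3 (a i) (b j) (a k) = 0 \<longleftrightarrow> m dvd k - i"
  "det3 (a i) (c j) (a k) = 0 \<longleftrightarrow> m dvd k - i"
  using abc[of k i j] det3_rotate[of "b i" "c j" "a k"] abc[of j k i] det3_rotate[of "a j" "b k" "c i"]
    bba[of j k i] det3_rotate[of "b j" "b k" "a i"] ccb[of j k i] det3_rotate[of "c j" "c k" "b i"]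
    aac[of j k i] det3_rotate[of "a j" "a k" "c i"] aab[of j k i] det3_rotate[of "a j" "a k" "b i"]
    aab[of k i j] det3_rotate[of "a i" "b j" "a k"] aac[of k i j] det3_rotate[of "a i" "c j" "a k"]
  by (simp_all add: ac_simps)

text \<open>The nine points are arranged so that every row and column contains each class once and
  each of the offsets \<open>x\<close>, \<open>u\<close>, \<open>v\<close> once. All six index sums
  are then \<open>0\<close>, and \<open>chasles\<close> applies.\<close>

lemma window:
  assumes cf: "cubic_form F G"
    and ne: "\<not> m dvd x - u" "\<not> m dvd x - v" "\<not> m dvd u - v"
    and sum: "\<alpha> + \<beta> + \<gamma> + x + u + v = 0"
    and z: "F (a (\<alpha> + x)) = 0" "F (a (\<alpha> + u)) = 0" "F (a (\<alpha> + v)) = 0"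
      "F (b (\<beta> + u)) = 0" "F (b (\<beta> + v)) = 0"
      "F (c (\<gamma> + x)) = 0" "F (c (\<gamma> + u)) = 0" "F (c (\<gamma> + v)) = 0"
  shows "F (b (\<beta> + x)) = 0"
proof -
  have ne': "\<not> m dvd u - x" "\<not> m dvd v - x" "\<not> m dvd v - u"
    using ne by (metis dvd_minus_iff minus_diff_eq)+
  have s: "\<gamma> = - \<alpha> - \<beta> - x - u - v" using sum by simp
  show ?thesis
    by (rule chasles[OF cf, of "a (\<alpha> + x)" "b (\<beta> + u)" "c (\<gamma> + v)" "b (\<beta> + v)" "c (\<gamma> + x)" "a (\<alpha> + u)"
        "c (\<gamma> + u)" "a (\<alpha> + v)" "b (\<beta> + x)"])
      (use z ne ne' in \<open>simp_all add: abc det_perms s algebra_simps\<close>)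
qed

end

text \<open>For \<open>m \<ge> 3\<close> three consecutive indices are distinct modulo
  \<open>m\<close>, as \<open>window\<close> requires. Each application extends a run of known zeros
  in one class by one index.\<close>

lemma (in cyclic_net) cubic_through_all:
  assumes cf: "cubic_form F G" and m: "m \<ge> 3"
    and za: "F (a 0) = 0" "F (a 1) = 0" "F (a 2) = 0" "F (a 3) = 0"
    and zb: "F (b 0) = 0" "F (b 1) = 0" "F (b 2) = 0"
    and zc: "F (c (-1)) = 0" "F (c (-2)) = 0"
  shows "F (a i) = 0" "F (b i) = 0" "F (c i) = 0"
proof -
  have ne: "\<not> m dvd 1" "\<not> m dvd 2" using m by (auto dest: zdvd_imp_le)
  interpret B: cyclic_net m b c a by (rule cyclic_net_rotate) unfold_locales
  interpret C: cyclic_net m c a b by (rule cyclic_net_rotate) unfold_locales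
  \<comment> \<open>The offset \<open>x\<close> marks the new point: with \<open>x = 2\<close> the
    runs in the first two classes grow upwards, with \<open>x = 0\<close> the run in the third class
    grows downwards.\<close>
  note wb = window[OF cf, of 2 0 1, simplified] and wc = B.window[OF cf, of 0 1 2, simplified]
    and wa = C.window[OF cf, of 2 0 1, simplified]
  have c3: "F (c (-3)) = 0" using wc[of 0 "-3" 0] za zb zc ne by simp
  have c4: "F (c (-4)) = 0" using wc[of 0 "-4" 1] za zb zc c3 ne by simp
  have b3: "F (b 3) = 0" using wb[of 0 1 "-4"] za zb zc c3 c4 ne by simp
  have c5: "F (c (-5)) = 0" using wc[of 1 "-5" 1] za zb zc c3 c4 b3 ne by simp
  \<comment> \<open>The points \<open>b 0\<close> to \<open>b 3\<close> stay fixed while the run of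
    \<open>a\<close> moves up and that of \<open>c\<close> moves down, which keeps the index sums
    equal to \<open>0\<close>.\<close>
  have W: "F (a (int n)) = 0 \<and> F (a (int n + 1)) = 0 \<and> F (a (int n + 2)) = 0 \<and> F (a (int n + 3)) = 0 \<and>
      F (c (- int n - 1)) = 0 \<and> F (c (- int n - 2)) = 0 \<and> F (c (- int n - 3)) = 0 \<and>
      F (c (- int n - 4)) = 0 \<and> F (c (- int n - 5)) = 0" for n
  proof (induction n)
    case 0
    then show ?case using za zc c3 c4 c5 by simp
  next
    case (Suc n)
    have a4: "F (a (int n + 4)) = 0"
      using wa[of "- int n - 5" "int n + 2" 0] Suc zb ne by (simp add: algebra_simps)
    have "F (c (- int n - 6)) = 0"
      using wc[of 1 "- int n - 6" "int n + 2"] Suc zb b3 a4 ne by (simp add: algebra_simps)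
    then show ?case using Suc a4 by (simp add: algebra_simps)
  qed
  have a: "F (a i) = 0" for i
  proof -
    have "a i = a (int (nat (i mod m)))" using m by (intro period) (simp add: mod_eq_dvd_iff[symmetric])
    then show ?thesis using W[of "nat (i mod m)"] by simp
  qed
  have c: "F (c i) = 0" for i
  proof -
    \<comment> \<open>\<open>W\<close> lists \<open>c\<close> at the indices
      \<open>- int n - 1\<close>, so \<open>- 1 - i\<close> is the number to reduce modulo
      \<open>m\<close>.\<close>
    have "i - (- int (nat ((- 1 - i) mod m)) - 1) = - ((- 1 - i) - (- 1 - i) mod m)"
      using m by simp
    then have "c i = c (- int (nat ((- 1 - i) mod m)) - 1)"
      by (intro period) (simp only: dvd_minus_iff dvd_minus_mod)
    then show ?thesis using W[of "nat ((- 1 - i) mod m)"] by simp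
  qed
  \<comment> \<open>With all of \<open>a\<close> and \<open>c\<close> known, two consecutive zeros
    among the \<open>b\<close> are enough to slide.\<close>
  have "F (b (int n)) = 0 \<and> F (b (int n + 1)) = 0" for n
  proof (induction n)
    case 0
    then show ?case using zb by simp
  next
    case (Suc n)
    have "F (b (int n + 2)) = 0"
      using wb[of "- int n - 3" "int n" 0] Suc a c ne by simp
    then show ?case using Suc by (simp add: algebra_simps)
  qed
  then have b: "F (b i) = 0" for i
  proof -
    have "b i = b (int (nat (i mod m)))" using m by (intro period) (simp add: mod_eq_dvd_iff[symmetric])
    then show ?thesis using \<open>\<And>n. F (b (int n)) = 0 \<and> F (b (int n + 1)) = 0\<close>[of "nat (i mod m)"] by simp
  qed
  show "F (a i) = 0" "F (b i) = 0" "F (c i) = 0" by (fact a b c)+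
qed

text \<open>If \<open>a i\<close> were singular, the line through \<open>a i\<close> and
  \<open>b j\<close> would carry a double zero at \<open>a i\<close> and zeros at \<open>b j\<close>
  and \<open>c (- i - j)\<close>, hence lie on the cubic. For \<open>m \<ge> 4\<close> this gives
  four distinct lines through \<open>a i\<close>, which forces the cubic to be zero.\<close>

lemma (in cyclic_net) regular_at_first_class:
  assumes m: "m \<ge> 4" and k: "cubic_nonzero k"
    and z: "\<And>i. cubic_eval k (a i) = 0" "\<And>i. cubic_eval k (b i) = 0" "\<And>i. cubic_eval k (c i) = 0"
  shows "cubic_regular_at k (a i)"
proof (rule ccontr)
  assume "\<not> cubic_regular_at k (a i)"
  then have d: "cubic_diff k (a i) v = 0" for v using z by (auto simp: cubic_regular_at_def)
  have ne: "\<not> m dvd 1" using m by (auto dest: zdvd_imp_le)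
  note cf = cubic_form_cubic_eval[of k]
  have line: "cubic_eval k (s *s a i + t *s b j) = 0" for s t j
  proof -
    have "det3 (a i) (b j) (c (- i - j)) = 0" "det3 (a i) (b j) (b (j + 1)) \<noteq> 0"
      using ne by (simp_all add: abc det_perms)
    then obtain x y where xy: "c (- i - j) = x *s a i + y *s b j"
      using span_of_det3_eq_0 by blast
    \<comment> \<open>The third point of the line is proportional to neither \<open>a i\<close> nor
      \<open>b j\<close>, so both of its coefficients are nonzero.\<close>
    have "det3 (a i) (c (- i - j)) (a (i + 1)) \<noteq> 0" "det3 (b j) (c (- i - j)) (b (j + 1)) \<noteq> 0"
      using ne bbc[of "j + 1" j "- i - j"] det3_rotate[of "b j" "c (- i - j)" "b (j + 1)"]
      by (simp_all add: det_perms)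
    then have "y \<noteq> 0" "x \<noteq> 0" unfolding xy by (auto simp: det3_def algebra_simps)
    moreover have "cubic_eval k (x *s a i + y *s b j) = 0" using z(3) xy by metis
    ultimately show ?thesis using cubic_form_double_zero[OF cf z(1) z(2) d] by blast
  qed
  have "cubic_eval k p = 0" for p
  proof (rule cubic_form_eq_0_of_four_concurrent_lines[OF cf, of "a i" "\<lambda>j. b (int j)"])
    fix j l :: nat assume "j < 4" "l < 4" "j \<noteq> l"
    then have "\<bar>int j - int l\<bar> < m" "int j - int l \<noteq> 0" using m by auto
    then have "\<not> m dvd int j - int l" using dvd_imp_le_int[of "int j - int l" m] m by auto
    then show "det3 (a i) (b (int j)) (b (int l)) \<noteq> 0" by (simp add: det_perms)
  qed (rule line)
  then show False using k cubic_eval_neq_0_of_nonzero by metis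
qed

lemma (in cyclic_net) exists_regular_cubic:
  assumes "m \<ge> 2"
  obtains k where "\<And>i. cubic_regular_at k (a i)" "\<And>i. cubic_regular_at k (b i)"
    "\<And>i. cubic_regular_at k (c i)"
proof -
  consider "m = 2" | "m = 3" | "m \<ge> 4" using assms by linarith
  then show thesis
  proof cases
    case 1
    \<comment> \<open>Each class has two points. The lines they span serve as factors: no point of
      one class lies on the line of another.\<close>
    obtain k where k: "\<And>x. cubic_eval k x = det3 (a 0) (a 1) x * det3 (b 0) (b 1) x * det3 (c 0) (c 1) x"
      using exists_cubic_eval_eq_prod unfolding det3_eq_dotp_cross by blast
    have per: "f i = f 0 \<or> f i = f 1" if "\<And>i j. 2 dvd i - j \<Longrightarrow> f i = f j" for f :: "int \<Rightarrow> complex ^ 3" and i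
    proof (cases "even i")
      case True then show ?thesis using that[of i 0] by simp
    next
      case False then show ?thesis using that[of i 1] by simp
    qed
    have 0: "det3 (a 0) (a 1) (a i) = 0" "det3 (b 0) (b 1) (b i) = 0" "det3 (c 0) (c 1) (c i) = 0" for i
      using per[of a i, OF period(1)[unfolded 1]] per[of b i, OF period(2)[unfolded 1]]
        per[of c i, OF period(3)[unfolded 1]] by auto
    note R = cubic_regular_at_prod[OF k det3_linear det3_linear det3_linear, of "b 0" "a 0" "a 0"]
    show thesis
      by (rule that[of k]; rule R) (use 1 0 in \<open>simp_all add: aab aac bba bbc cca ccb\<close>)
  next
    case 2
    \<comment> \<open>Modulo 3 the condition \<open>j + j + l = 0\<close> means
      \<open>l = j\<close>, so the line through \<open>a j\<close> and \<open>b j\<close> contains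
      \<open>c j\<close> and no other point of the third class. The three lines partition the
      net.\<close>
    obtain k where k: "\<And>x. cubic_eval k x = det3 (a 0) (b 0) x * det3 (a 1) (b 1) x * det3 (a 2) (b 2) x"
      using exists_cubic_eval_eq_prod unfolding det3_eq_dotp_cross by blast
    note R = cubic_regular_at_prod[OF k det3_linear det3_linear det3_linear, of "a 1" "a 0" "a 0"]
    show thesis
    proof (rule that[of k])
      have ne: "det3 (a 0) (b 0) (a 1) \<noteq> 0" "det3 (a 1) (b 1) (a 0) \<noteq> 0" "det3 (a 2) (b 2) (a 0) \<noteq> 0"
        using 2 by (simp_all add: det_perms)
      fix i
      show "cubic_regular_at k (a i)"
        by (rule R[OF ne]) (unfold abc det_perms 2, presburger)
      show "cubic_regular_at k (b i)"
        by (rule R[OF ne]) (unfold abc det_perms 2, presburger)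
      show "cubic_regular_at k (c i)"
        by (rule R[OF ne]) (unfold abc det_perms 2, presburger)
    qed
  next
    case 3
    \<comment> \<open>The nine starting points of \<open>cubic_through_all\<close>.\<close>
    obtain k where k: "cubic_nonzero k" "\<And>p. p \<in> set [a 0, a 1, a 2, a 3, b 0, b 1, b 2, c (-1), c (-2)]
        \<Longrightarrow> cubic_eval k p = 0"
      using exists_cubic_through_nine_points[of "[a 0, a 1, a 2, a 3, b 0, b 1, b 2, c (-1), c (-2)]"] by auto
    have z: "cubic_eval k (a i) = 0" "cubic_eval k (b i) = 0" "cubic_eval k (c i) = 0" for i
      using cubic_through_all[OF cubic_form_cubic_eval, of k i] 3 k(2) by simp_all
    interpret B: cyclic_net m b c a by (rule cyclic_net_rotate) unfold_locales
    interpret C: cyclic_net m c a b by (rule cyclic_net_rotate) unfold_locales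
    show thesis
      using that[of k] regular_at_first_class[OF 3 k(1) z] B.regular_at_first_class[OF 3 k(1) z(2,3,1)]
        C.regular_at_first_class[OF 3 k(1) z(3,1,2)] by blast
  qed
qed

section \<open>From the net to its dual vectors\<close>

theorem theorem5p3:
  fixes m :: nat
    and A :: "3 \<Rightarrow> (complex ^ 3) set set"
    and X :: "(complex ^ 3) set set"
  assumes "m \<ge> 2"
    and "three_net A X"
    and "net_realizes A (integer_mod_group m)"
  shows "algebraic_net A"
proof -
  have T: "\<forall>i. \<forall>l\<in>A i. proj_line l" "\<forall>i j. i \<noteq> j \<longrightarrow> A i \<inter> A j = {}"
    "\<forall>i j. i \<noteq> j \<longrightarrow> (\<forall>l\<in>A i. \<forall>l'\<in>A j. l \<inter> l' \<in> X)"
    "\<forall>P\<in>X. \<forall>i. \<exists>!l. l \<in> A i \<and> P \<subseteq> l"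
    using assms(2) unfolding three_net_def by - (elim conjE, assumption)+
  have lines: "\<And>i l. l \<in> A i \<Longrightarrow> proj_line l" using T(1) by blast
  have disj: "\<And>i j. i \<noteq> j \<Longrightarrow> A i \<inter> A j = {}" using T(2) by blast
  have meet: "\<And>i j l l'. i \<noteq> j \<Longrightarrow> l \<in> A i \<Longrightarrow> l' \<in> A j \<Longrightarrow> l \<inter> l' \<in> X" using T(3) by blast
  have unique: "\<And>P i. P \<in> X \<Longrightarrow> \<exists>!l. l \<in> A i \<and> P \<subseteq> l" using T(4) by simp
  define Z where "Z = {0..<int m}"
  have Z: "i mod int m \<in> Z" for i using assms(1) by (simp add: Z_def)
  have "carrier (integer_mod_group m) = Z"
    using assms(1) by (simp add: carrier_integer_mod_group Z_def)
  then obtain \<phi> :: "3 \<Rightarrow> int \<Rightarrow> (complex ^ 3) set"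
    where bij: "\<And>i. bij_betw (\<phi> i) Z (A i)"
      and mult: "\<And>x y. x \<in> Z \<Longrightarrow> y \<in> Z \<Longrightarrow> \<phi> 1 x \<inter> \<phi> 2 y \<subseteq> \<phi> 3 ((x + y) mod int m)"
    using assms(3) unfolding net_realizes_def mult_integer_mod_group by metis
  have \<phi>_in: "\<phi> i (x mod int m) \<in> A i" for i x using bij[of i] Z by (meson bij_betwE)
  have \<phi>_eq: "\<phi> i (x mod int m) = \<phi> i (y mod int m) \<longleftrightarrow> int m dvd x - y" for i x y
    using inj_on_eq_iff[OF bij_betw_imp_inj_on[OF bij[of i]] Z Z] by (simp add: mod_eq_dvd_iff)
  have "\<exists>u. u \<noteq> 0 \<and> l = {x. dotp u x = 0} \<and> dual_point l = range (\<lambda>t. t *s u)"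
    if "proj_line l" for l
    using proj_line_normal[OF that] by metis
  then obtain N where N: "\<And>l. proj_line l \<Longrightarrow>
      N l \<noteq> 0 \<and> l = {x. dotp (N l) x = 0} \<and> dual_point l = range (\<lambda>t. t *s N l)"
    by metis
  have det: "det3 (N l) (N l') (N l'') = 0 \<longleftrightarrow> l \<inter> l' \<subseteq> l''"
    if "i \<noteq> j" "l \<in> A i" "l' \<in> A j" "l'' \<in> A k" for i j k l l' l''
  proof -
    have "l \<noteq> l'" using that disj by blast
    then show ?thesis
      using inter_subset_iff_det3[of "N l" "N l'" "N l''"] N lines that by metis
  qed
  \<comment> \<open>Both \<open>l\<close> and \<open>l''\<close> belong to class \<open>i\<close>,
    which has exactly one line through the net point \<open>l \<inter> l'\<close>.\<close>
  have det_same: "det3 (N l) (N l'') (N l') = 0 \<longleftrightarrow> l = l''"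
    if "i \<noteq> j" "l \<in> A i" "l'' \<in> A i" "l' \<in> A j" for i j l l' l''
  proof -
    have "det3 (N l) (N l'') (N l') = 0 \<longleftrightarrow> l \<inter> l' \<subseteq> l''"
      using det[OF that(1,2,4,3)] det3_swap[of "N l" "N l'" "N l''"] by simp
    then show ?thesis using unique[OF meet[OF that(1,2,4)], of i] that by blast
  qed
  define a where "a i = N (\<phi> 1 (i mod int m))" for i
  define b where "b i = N (\<phi> 2 (i mod int m))" for i
  define c where "c i = N (\<phi> 3 (- i mod int m))" for i
  have \<phi>_eq_minus: "\<phi> 3 (- i mod int m) = \<phi> 3 (- j mod int m) \<longleftrightarrow> int m dvd i - j" for i j
    using dvd_minus_iff[of "int m" "i - j"] by (simp add: \<phi>_eq)
  interpret cyclic_net "int m" a b c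
  proof
    fix i j k
    have "det3 (a i) (b j) (c k) = 0 \<longleftrightarrow>
        \<phi> 1 (i mod int m) \<inter> \<phi> 2 (j mod int m) \<subseteq> \<phi> 3 (- k mod int m)"
      unfolding a_def b_def c_def by (rule det[OF _ \<phi>_in \<phi>_in \<phi>_in]) simp
    \<comment> \<open>The realization puts the line with index \<open>i + j\<close> through this net
      point, and it is the only line of the third class there.\<close>
    also have "\<dots> \<longleftrightarrow> \<phi> 3 ((i + j) mod int m) = \<phi> 3 (- k mod int m)"
    proof -
      have "\<phi> 1 (i mod int m) \<inter> \<phi> 2 (j mod int m) \<subseteq> \<phi> 3 ((i + j) mod int m)"
        using mult[OF Z Z, of i j] by (simp add: mod_add_eq)
      then show ?thesis
        using unique[OF meet[OF _ \<phi>_in[of 1 i] \<phi>_in[of 2 j]], of 3] \<phi>_in[of 3 "i + j"] \<phi>_in[of 3 "- k"]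
        by auto
    qed
    finally show "det3 (a i) (b j) (c k) = 0 \<longleftrightarrow> int m dvd i + j + k" by (simp add: \<phi>_eq)
    show "det3 (a i) (a j) (b k) = 0 \<longleftrightarrow> int m dvd i - j"
      unfolding a_def b_def \<phi>_eq[of 1, symmetric] by (rule det_same[OF _ \<phi>_in \<phi>_in \<phi>_in]) simp
    show "det3 (a i) (a j) (c k) = 0 \<longleftrightarrow> int m dvd i - j"
      unfolding a_def c_def \<phi>_eq[of 1, symmetric] by (rule det_same[OF _ \<phi>_in \<phi>_in \<phi>_in]) simp
    show "det3 (b i) (b j) (a k) = 0 \<longleftrightarrow> int m dvd i - j"
      unfolding a_def b_def \<phi>_eq[of 2, symmetric] by (rule det_same[OF _ \<phi>_in \<phi>_in \<phi>_in]) simp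
    show "det3 (b i) (b j) (c k) = 0 \<longleftrightarrow> int m dvd i - j"
      unfolding b_def c_def \<phi>_eq[of 2, symmetric] by (rule det_same[OF _ \<phi>_in \<phi>_in \<phi>_in]) simp
    show "det3 (c i) (c j) (a k) = 0 \<longleftrightarrow> int m dvd i - j"
      unfolding a_def c_def \<phi>_eq_minus[symmetric]
      by (rule det_same[OF _ \<phi>_in \<phi>_in \<phi>_in]) simp
    show "det3 (c i) (c j) (b k) = 0 \<longleftrightarrow> int m dvd i - j"
      unfolding b_def c_def \<phi>_eq_minus[symmetric]
      by (rule det_same[OF _ \<phi>_in \<phi>_in \<phi>_in]) simp
  next
    fix i j assume ij: "int m dvd i - j"
    show "a i = a j" "b i = b j" using ij \<phi>_eq[of _ i j] by (simp_all add: a_def b_def)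
    show "c i = c j" using ij \<phi>_eq_minus[of i j] by (simp add: c_def)
  qed
  have "int m \<ge> 2" using assms(1) by simp
  then obtain k where k: "\<And>i. cubic_regular_at k (a i)" "\<And>i. cubic_regular_at k (b i)"
    "\<And>i. cubic_regular_at k (c i)"
    using exists_regular_cubic by blast
  have "cubic_regular_at k (N l)" if l: "l \<in> A i" for i l
  proof -
    \<comment> \<open>Every line of the net occurs among the vectors \<open>a\<close>,
      \<open>b\<close>, \<open>c\<close>; in the third class the line with group element
      \<open>x\<close> has index \<open>- x\<close>.\<close>
    obtain x where x: "x \<in> Z" "l = \<phi> i x" using l bij[of i] by (metis bij_betw_imp_surj_on imageE)
    have "x mod int m = x" "- (- x) mod int m = x" using x(1) by (simp_all add: Z_def)
    then have "a x = N (\<phi> 1 x)" "b x = N (\<phi> 2 x)" "c (- x) = N (\<phi> 3 x)"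
      by (simp_all add: a_def b_def c_def)
    then show ?thesis using k[of x] k(3)[of "- x"] exhaust_3[of i] x(2) by metis
  qed
  then have "dual_point l \<in> regular_points k" if "l \<in> A i" for i l
    using range_in_regular_points N lines that by metis
  moreover have "cubic_nonzero k" using cubic_nonzero_of_regular_at k(1) by blast
  ultimately show ?thesis unfolding algebraic_net_def by blast
qed

end
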